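(* The multiplier $\alpha(0)\alpha(1)$ is not exceptional for the Fibonacci-Dyck shift $F$; that is, there is no $n\in\mathbb N$ such that $\alpha(0)\alpha(1)$ is exceptional at period $n$.
   Context: The Dyck inverse monoid $\mathcal D_2$ is the monoid with zero generated by $\alpha_-(0),\alpha_-(1),\alpha_+(0),\alpha_+(1)$ with relations $\alpha_-(n)\alpha_+(m)=\mathbf 1$ if $n=m$ and $=0$ if $n\ne m$. Let $\mathcal D_2^-$ (resp. $\mathcal D_2^+$) be the free semigroup (without identity) generated in $\mathcal D_2$ by $\alpha_-(0),\alpha_-(1)$ (resp. $\alpha_+(0),\alpha_+(1)$). Fibonacci-Dyck shift $F$: consider the directed graph with vertices $0,1$ and six edges: $\beta^-(0)$ and $\beta^+(0)$ are loops at vertex $0$; $\beta^-$ goes from $0$ to $1$; $\beta^-(1)$ goes from $1$ to $0$; $\beta^+$ goes from $1$ to $0$; $\beta^+(1)$ goes from $0$ to $1$. Label the edges by $\lambda(\beta^-(i))=\alpha_-(i)$, $\lambda(\beta^+(i))=\alpha_+(i)$ for $i=0,1$, and $\lambda(\beta^-)=\lambda(\beta^+)=\mathbf 1$, and for a directed path $b=(b_1,\dots,b_I)$ set $\lambda(b)=\lambda(b_1)\cdots\lambda(b_I)\in\mathcal D_2$. $F$ is the subshift over the six-letter alphabet of edges whose admissible words are exactly the finite directed paths $b$ with $\lambda(b)\neq 0$. Multipliers: a word in the symbols $\alpha(0),\alpha(1)$ is primitive if it is nonempty and not a proper power of another word; a multiplier is an equivalence class of primitive words under cyclic permutation, denoted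 by any representative. Let $p\in F$ be periodic with smallest period $\Pi(p)$ (the length of its orbit), and write $p_{[i,i+\Pi(p))}=(p_i,\dots,p_{i+\Pi(p)-1})$. The point $p$ and its orbit have negative (resp. positive) multiplier if $\lambda(p_{[i,i+\Pi(p))})\in\mathcal D_2^-$ (resp. $\in\mathcal D_2^+$) for some $i\in\mathbb Z$. For a multiplier $\mu$, they have negative multiplier $\mu_-$ if there are $i\in\mathbb Z$, a representative $\alpha(n_1)\cdots\alpha(n_J)$ of $\mu$ and $\kappa\in\mathbb N$ ($\kappa\geq1$) with $\lambda(p_{[i,i+\Pi(p))})=(\alpha_-(n_1)\cdots\alpha_-(n_J))^\kappa$; they have positive multiplier $\mu_+$ if there are such data with $\lambda(p_{[i,i+\Pi(p))})=(\alpha_+(n_J)\cdots\alpha_+(n_1))^\kappa$. For $n\in\mathbb N$ let $\mathcal O_n^-$, $\mathcal O_n^+$, $\mathcal O_n(\mu_-)$, $\mathcal O_n(\mu_+)$ be the sets of periodic orbits of $F$ of length $n$ with, respectively, negative multiplier, positive multiplier, multiplier $\mu_-$, multiplier $\mu_+$. A multiplier $\mu$ is exceptional at period $n$ if $\operatorname{card}(\mathcal O_n(\mu_-)\cup\mathcal O_n(\mu_+))>\max\{\operatorname{card}(\mathcal O_n^-),\operatorname{card}(\mathcal O_n^+)\}$; it is exceptional if it is exceptional at some period $n\in\mathbb N$. *)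

theory Defs
  imports Main
begin

section \<open>The Dyck inverse monoid on two pairs of generators\<close>

datatype idx = I0 | I1

datatype gen = Neg idx | Pos idx

text \<open>
  The free monoid with zero over \<^typ>\<open>gen\<close> is \<^typ>\<open>gen list option\<close>: \<open>None\<close> is the adjoined
  zero and \<open>Some []\<close> the identity.
\<close>

fun free_mult :: "gen list option \<Rightarrow> gen list option \<Rightarrow> gen list option" where
  "free_mult (Some u) (Some v) = Some (u @ v)"
| "free_mult None y = None"
| "free_mult (Some u) None = None"

inductive dyck_cong :: "gen list option \<Rightarrow> gen list option \<Rightarrow> bool" where
  cancel: "dyck_cong (Some [Neg n, Pos n]) (Some [])"
| annihilate: "n \<noteq> m \<Longrightarrow> dyck_cong (Some [Neg n, Pos m]) None"
| refl: "dyck_cong x x"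
| sym: "dyck_cong x y \<Longrightarrow> dyck_cong y x"
| trans: "dyck_cong x y \<Longrightarrow> dyck_cong y z \<Longrightarrow> dyck_cong x z"
| mult: "dyck_cong x x' \<Longrightarrow> dyck_cong y y' \<Longrightarrow> dyck_cong (free_mult x y) (free_mult x' y')"

lemma equivp_dyck_cong: "equivp dyck_cong"
  by (intro equivpI reflpI sympI transpI) (blast intro: dyck_cong.intros)+

quotient_type dyck = "gen list option" / dyck_cong
  by (rule equivp_dyck_cong)

instantiation dyck :: "{monoid_mult, mult_zero}"
begin

lift_definition zero_dyck :: dyck is None .

lift_definition one_dyck :: dyck is "Some []" .

lift_definition times_dyck :: "dyck \<Rightarrow> dyck \<Rightarrow> dyck" is free_mult
  by (rule dyck_cong.mult)

instance
proof
  have assoc: "free_mult (free_mult x y) z = free_mult x (free_mult y z)" for x y z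
    by (cases x; cases y; cases z) auto
  have left_one: "free_mult (Some []) x = x" and right_one: "free_mult x (Some []) = x"
    and right_zero: "free_mult x None = None" for x
    by (cases x; simp)+
  fix a b c :: dyck
  show "a * b * c = a * (b * c)" by transfer (simp add: assoc dyck_cong.refl)
  show "1 * a = a" by transfer (simp add: left_one dyck_cong.refl)
  show "a * 1 = a" by transfer (simp add: right_one dyck_cong.refl)
  show "0 * a = 0" by transfer (simp add: dyck_cong.refl)
  show "a * 0 = 0" by transfer (simp add: right_zero dyck_cong.refl)
qed

end

lift_definition \<alpha>neg :: "idx \<Rightarrow> dyck" is "\<lambda>n. Some [Neg n]" .

lift_definition \<alpha>pos :: "idx \<Rightarrow> dyck" is "\<lambda>n. Some [Pos n]" .

lemma neg_pos_same: "\<alpha>neg n * \<alpha>pos n = 1"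
  by transfer (simp add: dyck_cong.cancel)

lemma neg_pos_diff: "n \<noteq> m \<Longrightarrow> \<alpha>neg n * \<alpha>pos m = 0"
  by transfer (simp add: dyck_cong.annihilate)

inductive_set dyck_neg :: "dyck set" where
  gen: "\<alpha>neg n \<in> dyck_neg"
| mult: "x \<in> dyck_neg \<Longrightarrow> y \<in> dyck_neg \<Longrightarrow> x * y \<in> dyck_neg"

inductive_set dyck_pos :: "dyck set" where
  gen: "\<alpha>pos n \<in> dyck_pos"
| mult: "x \<in> dyck_pos \<Longrightarrow> y \<in> dyck_pos \<Longrightarrow> x * y \<in> dyck_pos"


section \<open>The Fibonacci-Dyck shift\<close>

datatype vertex = V0 | V1

text \<open>
  \<open>BNeg i\<close> and \<open>BPos i\<close> stand for $\beta^-(i)$ and $\beta^+(i)$, while \<open>BNeg1\<close> and \<open>BPos1\<close>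
  stand for the edges $\beta^-$ and $\beta^+$ that carry the label 1.
\<close>

datatype edge = BNeg idx | BPos idx | BNeg1 | BPos1

fun src :: "edge \<Rightarrow> vertex" where
  "src (BNeg I0) = V0"
| "src (BPos I0) = V0"
| "src BNeg1 = V0"
| "src (BNeg I1) = V1"
| "src BPos1 = V1"
| "src (BPos I1) = V0"

fun tgt :: "edge \<Rightarrow> vertex" where
  "tgt (BNeg I0) = V0"
| "tgt (BPos I0) = V0"
| "tgt BNeg1 = V1"
| "tgt (BNeg I1) = V0"
| "tgt BPos1 = V0"
| "tgt (BPos I1) = V1"

fun edge_label :: "edge \<Rightarrow> dyck" where
  "edge_label (BNeg i) = \<alpha>neg i"
| "edge_label (BPos i) = \<alpha>pos i"
| "edge_label BNeg1 = 1"
| "edge_label BPos1 = 1"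

definition path_label :: "edge list \<Rightarrow> dyck" where
  "path_label b = prod_list (map edge_label b)"

definition is_path :: "edge list \<Rightarrow> bool" where
  "is_path b \<longleftrightarrow> successively (\<lambda>e f. tgt e = src f) b"

definition admissible :: "edge list \<Rightarrow> bool" where
  "admissible b \<longleftrightarrow> is_path b \<and> path_label b \<noteq> 0"

text \<open>\<open>window p i n\<close> is the word $p_{[i, i+n)}$.\<close>

definition window :: "(int \<Rightarrow> 'a) \<Rightarrow> int \<Rightarrow> nat \<Rightarrow> 'a list" where
  "window p i n = map (\<lambda>j. p (i + int j)) [0..<n]"

definition fib_dyck :: "(int \<Rightarrow> edge) set" where
  "fib_dyck = {p. \<forall>i n. admissible (window p i n)}"

text \<open>
  The definition only asks that every word of a point is admissible. Conversely every admissible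
  word occurs in a point, so the language of \<^const>\<open>fib_dyck\<close> is exactly the set of admissible
  words.
\<close>

lemma path_label_simps [simp]:
  "path_label [] = 1"
  "path_label (e # b) = edge_label e * path_label b"
  "path_label (b @ c) = path_label b * path_label c"
  by (induction b) (simp_all add: path_label_def mult.assoc)

lemma mult_neg_nonzero: "x * \<alpha>neg n \<noteq> 0" if "x \<noteq> 0"
proof
  assume "x * \<alpha>neg n = 0"
  then have "x * (\<alpha>neg n * \<alpha>pos n) = 0" by (simp flip: mult.assoc)
  with that show False by (simp add: neg_pos_same)
qed

lemma pos_mult_nonzero: "\<alpha>pos n * x \<noteq> 0" if "x \<noteq> 0"
proof
  assume "\<alpha>pos n * x = 0"
  then have "(\<alpha>neg n * \<alpha>pos n) * x = 0" by (simp add: mult.assoc)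
  with that show False by (simp add: neg_pos_same)
qed

lemma admissible_infix: "admissible b" if "admissible (a @ b @ c)"
proof -
  have "path_label b \<noteq> 0"
    using that by (metis admissible_def mult_zero_left mult_zero_right path_label_simps(3))
  with that show ?thesis
    by (auto simp: admissible_def is_path_def successively_append_iff)
qed

lemma admissible_left_loops:
  "admissible b \<Longrightarrow> b \<noteq> [] \<Longrightarrow> src (hd b) = V0 \<Longrightarrow> admissible (replicate k (BPos I0) @ b)"
proof (induction k)
  case (Suc k)
  then show ?case
    by (cases k) (auto simp: admissible_def is_path_def successively_Cons pos_mult_nonzero)
qed simp

lemma admissible_right_loops:
  "admissible b \<Longrightarrow> b \<noteq> [] \<Longrightarrow> tgt (last b) = V0 \<Longrightarrow> admissible (b @ replicate k (BNeg I0))"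
proof (induction k arbitrary: b)
  case (Suc k)
  have "admissible (b @ [BNeg I0])"
    using Suc.prems
    by (auto simp: admissible_def is_path_def successively_append_iff mult_neg_nonzero)
  from Suc.IH[OF this] show ?case by simp
qed simp

lemma admissible_extend:
  assumes "admissible b"
  shows "\<exists>a c. admissible (a @ b @ c) \<and> a @ b @ c \<noteq> [] \<and>
    src (hd (a @ b @ c)) = V0 \<and> tgt (last (a @ b @ c)) = V0"
proof (cases "b = []")
  case True
  have "path_label [BNeg I0] \<noteq> 0"
    using assms mult_neg_nonzero[of 1 I0] by (auto simp: admissible_def True)
  then show ?thesis
    by (intro exI[of _ "[]"] exI[of _ "[BNeg I0]"]) (simp add: True admissible_def is_path_def)
next
  case False
  define a where "a = (if src (hd b) = V0 then [] else [BPos I1])"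
  define c where "c = (if tgt (last b) = V0 then [] else [BNeg I1])"
  have V: "v \<noteq> V0 \<longleftrightarrow> v = V1" for v by (cases v) auto
  have "admissible (a @ b @ c)"
    using assms False
    by (auto simp: a_def c_def admissible_def is_path_def successively_append_iff
        successively_Cons V mult_neg_nonzero pos_mult_nonzero)
  then show ?thesis
    using False by (intro exI[of _ a] exI[of _ c]) (auto simp: a_def c_def)
qed

lemma window_append: "window p i (m + n) = window p i m @ window p (i + int m) n"
  by (rule nth_equalityI) (auto simp: window_def nth_append add.assoc)

lemma admissible_iff_occurs: "admissible b \<longleftrightarrow> (\<exists>p\<in>fib_dyck. \<exists>i n. window p i n = b)"
proof
  assume "admissible b"
  then obtain a c where ext: "admissible (a @ b @ c)" "a @ b @ c \<noteq> []"
    "src (hd (a @ b @ c)) = V0" "tgt (last (a @ b @ c)) = V0"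
    using admissible_extend by blast
  define w where "w = a @ b @ c"
  define p where "p i = (if i < 0 then BPos I0 else if i < int (length w) then w ! nat i else BNeg I0)"
    for i :: int
  have big: "window p (- int N) (N + length w + N) = (replicate N (BPos I0) @ w) @ replicate N (BNeg I0)"
    for N
    by (rule nth_equalityI) (auto simp: window_def p_def nth_append nat_diff_distrib' nat_add_distrib)
  have "admissible ((replicate N (BPos I0) @ w) @ replicate N (BNeg I0))" for N
    using ext unfolding w_def[symmetric]
    by (intro admissible_right_loops admissible_left_loops) (auto simp: hd_append)
  then have adm: "admissible (window p (- int N) (N + length w + N))" for N
    by (simp only: big)
  have "admissible (window p i n)" for i n
  proof -
    define N where "N = nat \<bar>i\<bar> + n"
    define m where "m = nat (i + int N)"
    define k where "k = N + length w + N - (m + n)"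
    have eq: "m + (n + k) = N + length w + N" and i: "- int N + int m = i"
      by (auto simp: N_def m_def k_def)
    have "window p (- int N) (N + length w + N)
        = window p (- int N) m @ window p i n @ window p (i + int n) k"
      unfolding eq[symmetric] window_append i ..
    then show ?thesis
      using adm[of N] by (metis admissible_infix)
  qed
  then have "p \<in> fib_dyck" by (simp add: fib_dyck_def)
  moreover have "window p (int (length a)) (length b) = b"
    by (rule nth_equalityI)
      (auto simp: window_def p_def w_def nth_append nat_add_distrib)
  ultimately show "\<exists>p\<in>fib_dyck. \<exists>i n. window p i n = b" by blast
qed (auto simp: fib_dyck_def)


section \<open>Periodic points and their orbits\<close>

definition periodic :: "(int \<Rightarrow> 'a) \<Rightarrow> bool" where
  "periodic p \<longleftrightarrow> (\<exists>k\<ge>1. \<forall>i. p (i + int k) = p i)"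

definition min_period :: "(int \<Rightarrow> 'a) \<Rightarrow> nat" where
  "min_period p = (LEAST k. k \<ge> 1 \<and> (\<forall>i. p (i + int k) = p i))"

definition shift_orbit :: "(int \<Rightarrow> 'a) \<Rightarrow> (int \<Rightarrow> 'a) set" where
  "shift_orbit p = range (\<lambda>k. \<lambda>i. p (i + k))"

definition period_label :: "(int \<Rightarrow> edge) \<Rightarrow> int \<Rightarrow> dyck" where
  "period_label p i = path_label (window p i (min_period p))"


section \<open>Multipliers\<close>

text \<open>A word in the symbols $\alpha(0), \alpha(1)$ is represented by its list of indices.\<close>

definition primitive :: "idx list \<Rightarrow> bool" where
  "primitive w \<longleftrightarrow> w \<noteq> [] \<and> \<not> (\<exists>u k. k \<ge> 2 \<and> w = concat (replicate k u))"

definition cyclic_rel :: "(idx list \<times> idx list) set" where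
  "cyclic_rel = {(u, v). primitive u \<and> primitive v \<and> (\<exists>k. v = rotate k u)}"

definition multipliers :: "idx list set set" where
  "multipliers = {w. primitive w} // cyclic_rel"

definition multiplier_of :: "idx list \<Rightarrow> idx list set" where
  "multiplier_of w = cyclic_rel `` {w}"

lemma primitive_I0_I1: "primitive [I0, I1]"
proof -
  have False if "k \<ge> 2" and eq: "[I0, I1] = concat (replicate k u)" for u k
  proof -
    obtain j where k: "k = Suc (Suc j)"
      using \<open>k \<ge> 2\<close> by (metis add_2_eq_Suc le_Suc_ex)
    then have eq: "[I0, I1] = u @ u @ concat (replicate j u)" using eq by simp
    show False
    proof (cases u)
      case Nil
      with eq show False by simp
    next
      case (Cons x xs)
      with eq show False by (cases xs) auto
    qed
  qed
  then show ?thesis unfolding primitive_def by blast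
qed

lemma multiplier_of_I0_I1: "multiplier_of [I0, I1] \<in> multipliers"
  unfolding multipliers_def multiplier_of_def by (rule quotientI) (simp add: primitive_I0_I1)

definition has_neg_multiplier :: "(int \<Rightarrow> edge) \<Rightarrow> bool" where
  "has_neg_multiplier p \<longleftrightarrow> (\<exists>i. period_label p i \<in> dyck_neg)"

definition has_pos_multiplier :: "(int \<Rightarrow> edge) \<Rightarrow> bool" where
  "has_pos_multiplier p \<longleftrightarrow> (\<exists>i. period_label p i \<in> dyck_pos)"

definition has_multiplier_neg :: "idx list set \<Rightarrow> (int \<Rightarrow> edge) \<Rightarrow> bool" where
  "has_multiplier_neg \<mu> p \<longleftrightarrow>
    (\<exists>i. \<exists>w\<in>\<mu>. \<exists>\<kappa>\<ge>1. period_label p i = prod_list (map \<alpha>neg w) ^ \<kappa>)"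

definition has_multiplier_pos :: "idx list set \<Rightarrow> (int \<Rightarrow> edge) \<Rightarrow> bool" where
  "has_multiplier_pos \<mu> p \<longleftrightarrow>
    (\<exists>i. \<exists>w\<in>\<mu>. \<exists>\<kappa>\<ge>1. period_label p i = prod_list (map \<alpha>pos (rev w)) ^ \<kappa>)"

text \<open>
  These sets are finite, a point of period \<open>n\<close> being determined by \<open>n\<close> letters of a finite
  alphabet, so \<^const>\<open>card\<close> below is the true cardinality.
\<close>

definition orbits_with :: "nat \<Rightarrow> ((int \<Rightarrow> edge) \<Rightarrow> bool) \<Rightarrow> (int \<Rightarrow> edge) set set" where
  "orbits_with n P = {shift_orbit p | p. p \<in> fib_dyck \<and> periodic p \<and> min_period p = n \<and> P p}"

definition exceptional_at :: "idx list set \<Rightarrow> nat \<Rightarrow> bool" where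
  "exceptional_at \<mu> n \<longleftrightarrow>
    card (orbits_with n (has_multiplier_neg \<mu>) \<union> orbits_with n (has_multiplier_pos \<mu>)) >
    max (card (orbits_with n has_neg_multiplier)) (card (orbits_with n has_pos_multiplier))"

definition exceptional :: "idx list set \<Rightarrow> bool" where
  "exceptional \<mu> \<longleftrightarrow> (\<exists>n\<ge>1. exceptional_at \<mu> n)"

end

theory Submission
  imports Defs
begin

text \<open>
  Read a path as a word of brackets: \<open>BNeg n\<close> opens a bracket of type \<open>n\<close>, \<open>BPos n\<close> closes one, and
  \<open>BNeg1\<close>, \<open>BPos1\<close> are neutral. A periodic point has a negative multiplier iff some
  of its openings are never closed; a period that starts at such an unmatched opening is labelled by
  the word of the indices of the unmatched openings in it. For the multiplier \<open>\<alpha>(0)\<alpha>(1)\<close>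
  the unmatched openings alternate between the types 0 and 1 along the point.

  Time reversal exchanges opening and closing brackets, so the orbits with multiplier \<open>\<mu>\<^sub>+\<close> are no
  more numerous than those with multiplier \<open>\<mu>\<^sub>-\<close> (\<open>card_pos_le_card_neg\<close>). Hence it suffices that the
  orbits with multiplier \<open>(\<alpha>(0)\<alpha>(1))\<^sub>-\<close> make up at most half of all orbits of the same length with
  negative multiplier (\<open>card_neg_orbits_le\<close>). This follows from an injection of the former into the
  other orbits with negative multiplier.

  The injection is a local surgery that exploits that \<open>BNeg I1\<close> and \<open>BPos1\<close> are parallel edges, both
  from vertex 1 to vertex 0: replacing one by the other keeps a path a path. Call a
  position a switch if it carries an unmatched \<open>BNeg I1\<close> (written 1), or a \<open>BPos1\<close> that lies inside no
  matched bracket (written t). At switches the two edges may be exchanged at will without disturbing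
  the matching of the other brackets (\<open>free_set_switches\<close>). Between two successive unmatched openings
  of type 0, the switches of a point with multiplier \<open>(\<alpha>(0)\<alpha>(1))\<^sub>-\<close> read \<open>t\<^sup>a 1 t\<^sup>b\<close>: exactly one
  of them is a 1. The surgery turns this into
    \<^item> \<open>t\<^sup>a\<^sup>+\<^sup>1\<close> if \<open>b = 0\<close>,
    \<^item> \<open>t\<^sup>a 1 1 t\<^sup>b\<^sup>-\<^sup>1\<close> if \<open>b \<ge> 1\<close>.
  Both the original word and its case can be read off the result, so the map is injective
  (\<open>respread_inject\<close>). The result never has exactly one 1 in such a gap, so it does not have the
  multiplier \<open>\<alpha>(0)\<alpha>(1)\<close> (\<open>respread_not_alternating\<close>); it has a negative multiplier, since the unmatched
  openings of type 0 survive. As the rule commutes with the shift and is injective, it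
  preserves smallest periods and acts on orbits.
\<close>

section \<open>The Dyck monoid acting on stacks\<close>

fun push_pop :: "gen \<Rightarrow> idx list \<Rightarrow> idx list option" where
  "push_pop (Neg n) s = Some (n # s)"
| "push_pop (Pos n) [] = None"
| "push_pop (Pos n) (m # s) = (if m = n then Some s else None)"

fun run :: "gen list option \<Rightarrow> idx list \<Rightarrow> idx list option" where
  "run None s = None"
| "run (Some []) s = Some s"
| "run (Some (g # w)) s = Option.bind (push_pop g s) (run (Some w))"

lemma run_free_mult: "run (free_mult x y) s = Option.bind (run x s) (run y)"
proof (cases x)
  case (Some u)
  show ?thesis
  proof (cases y)
    case None
    then show ?thesis using Some by (cases "run x s") auto
  next
    case (Some v)
    have "run (Some (u @ v)) s = Option.bind (run (Some u) s) (run (Some v))"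
    proof (induction u arbitrary: s)
      case (Cons g u)
      then show ?case by (cases "push_pop g s") auto
    qed simp
    then show ?thesis using Some \<open>x = Some u\<close> by simp
  qed
qed simp

lemma run_dyck_cong: "dyck_cong x y \<Longrightarrow> run x = run y"
proof (induction rule: dyck_cong.induct)
  case (mult x x' y y')
  then show ?case by (intro ext) (simp only: run_free_mult)
qed (auto simp: fun_eq_iff)

text \<open>
  The right action of the Dyck monoid on stacks by partial maps: negative generators push and positive
  generators pop, failing on a wrong or missing top. It separates the elements that matter
  here: a nonzero outcome certifies that a label is nonzero, and an outcome from the empty stack
  determines the label (\<open>scan_empty_label\<close> below).
\<close>

lift_definition act :: "dyck \<Rightarrow> idx list \<Rightarrow> idx list option" is run
  by (rule run_dyck_cong)

lemma act_zero [simp]: "act 0 s = None"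
  by transfer simp

lemma act_one [simp]: "act 1 = Some"
  by transfer auto

lemma act_mult [simp]: "act (x * y) s = Option.bind (act x s) (act y)"
  by transfer (rule run_free_mult)

lemma act_neg [simp]: "act (\<alpha>neg n) s = Some (n # s)"
  by transfer simp

lemma act_pos [simp]:
  "act (\<alpha>pos n) [] = None"
  "act (\<alpha>pos n) (m # s) = (if m = n then Some s else None)"
  by (transfer, simp)+

abbreviation scan :: "edge list \<Rightarrow> idx list \<Rightarrow> idx list option" where
  "scan b \<equiv> act (path_label b)"

lemma act_edge_append: "act (edge_label e) s = Some u \<Longrightarrow> act (edge_label e) (s @ s') = Some (u @ s')"
  by (cases e; cases s) (auto split: if_splits)

text \<open>
  Extra entries at the bottom of the stack are never looked at by a run that succeeds without them.
\<close>

lemma scan_append_stack: "scan b s = Some u \<Longrightarrow> scan b (s @ s') = Some (u @ s')"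
proof (induction b arbitrary: s)
  case (Cons e b)
  then show ?case by (auto simp: bind_eq_Some_conv dest: act_edge_append)
qed simp

lemma scan_ne_None_mono: "scan b [] \<noteq> None \<Longrightarrow> scan b s \<noteq> None"
  using scan_append_stack[of b "[]" _ s] by auto

lemma act_prod_neg: "act (prod_list (map \<alpha>neg u)) s = Some (rev u @ s)"
  by (induction u arbitrary: s) auto

text \<open>
  A run that starts from the empty stack cancels every closing bracket against the opening it pops,
  so the label is the product of the negative generators that remain, in the order of pushing.
\<close>

lemma scan_empty_label:
  "scan b [] = Some u \<Longrightarrow> path_label b = prod_list (map \<alpha>neg (rev u))"
proof (induction b arbitrary: u rule: rev_induct)
  case (snoc e b)
  then obtain v where v: "scan b [] = Some v" "act (edge_label e) v = Some u"
    by (auto simp: bind_eq_Some_conv)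
  have "prod_list (map \<alpha>neg (rev v)) * edge_label e = prod_list (map \<alpha>neg (rev u))"
    using v(2) by (cases e; cases v) (auto simp: mult.assoc neg_pos_same split: if_splits)
  then show ?case using snoc.IH[OF v(1)] by simp
qed simp

lemma prod_neg_in_dyck_neg: "u \<noteq> [] \<Longrightarrow> prod_list (map \<alpha>neg u) \<in> dyck_neg"
proof (induction u)
  case (Cons n u)
  then show ?case by (cases u) (auto intro: dyck_neg.intros)
qed simp

fun pushed :: "edge \<Rightarrow> idx list" where
  "pushed (BNeg n) = [n]"
| "pushed _ = []"

text \<open>
  The indices of the openings that are not closed later in the word. The opening at the head of
  \<open>e # b\<close> stays on the stack iff \<open>b\<close> never pops below the level at which it starts, that is, iff
  \<open>b\<close> can be run from the empty stack.
\<close>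

fun spine :: "edge list \<Rightarrow> idx list" where
  "spine [] = []"
| "spine (e # b) = (if scan b [] = None then [] else pushed e) @ spine b"

text \<open>
  Induction on the word needs arbitrary initial stacks. A successful run eats a top part \<open>s1\<close> of the
  stack and puts the spine in its place; \<open>s1\<close> is the shortest stack from which the run succeeds, and
  this minimality decides, for an opening in front of the word, whether it gets closed (\<open>s1\<close>
  nonempty) or joins the spine.
\<close>

lemma scan_decomp:
  "scan b s = Some u \<Longrightarrow>
    \<exists>s1 s2. s = s1 @ s2 \<and> u = rev (spine b) @ s2 \<and> scan b s1 = Some (rev (spine b)) \<and>
      (\<forall>t. scan b t \<noteq> None \<longrightarrow> length s1 \<le> length t)"
proof (induction b arbitrary: s)
  case (Cons e b)
  then obtain s' where s': "act (edge_label e) s = Some s'" "scan b s' = Some u"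
    by (auto simp: bind_eq_Some_conv)
  obtain s1 s2 where d: "s' = s1 @ s2" "u = rev (spine b) @ s2" "scan b s1 = Some (rev (spine b))"
    and least: "\<And>t. scan b t \<noteq> None \<Longrightarrow> length s1 \<le> length t"
    using Cons.IH[OF s'(2)] by blast
  show ?case
  proof (cases e)
    case (BNeg n)
    show ?thesis
    proof (cases s1)
      case Nil
      have "scan b [n] = Some (rev (spine b) @ [n])"
        using scan_append_stack[of b "[]" _ "[n]"] d(3) Nil by simp
      then show ?thesis
        using Nil d s' BNeg by (intro exI[of _ "[]"] exI[of _ s]) auto
    next
      case (Cons m s1')
      have "scan b [] = None" using least[of "[]"] Cons by (cases "scan b []") auto
      then show ?thesis
        using Cons d s' BNeg least by (intro exI[of _ s1'] exI[of _ s2]) fastforce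
    qed
  next
    case (BPos n)
    then obtain s0 where s0: "s = n # s0" "s' = s0"
      using s'(1) by (cases s) (auto split: if_splits)
    have "length (n # s1) \<le> length t" if "scan (e # b) t \<noteq> None" for t
      using that least BPos by (cases t) (auto split: if_splits)
    then show ?thesis
      using s0 d BPos by (intro exI[of _ "n # s1"] exI[of _ s2]) auto
  qed (use s' d least in auto)
qed simp

lemma scan_empty_spine: "scan b [] = Some u \<Longrightarrow> u = rev (spine b)"
  using scan_decomp[of b "[]" u] by auto

section \<open>Free cuts and switches\<close>

abbreviation (input) translate :: "int \<Rightarrow> (int \<Rightarrow> 'a) \<Rightarrow> int \<Rightarrow> 'a" where
  "translate s p \<equiv> \<lambda>i. p (i + s)"

lemma window_0 [simp]: "window p i 0 = []"
  by (simp add: window_def)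

lemma window_Suc: "window p i (Suc m) = p i # window p (i + 1) m"
  using window_append[of p i 1 m] by (simp add: window_def)

lemma window_cong: "(\<And>k. i \<le> k \<Longrightarrow> k < i + int m \<Longrightarrow> p k = q k) \<Longrightarrow> window p i m = window q i m"
  by (auto simp: window_def)

lemma window_translate: "window (translate s p) i m = window p (i + s) m"
  by (simp add: window_def algebra_simps)

lemma scan_window_append:
  "scan (window p i (m + k)) s =
    Option.bind (scan (window p i m) s) (scan (window p (i + int m) k))"
  by (simp add: window_append)

lemma scan_window_insert:
  "scan (window p i (m + Suc k)) s =
    Option.bind (Option.bind (scan (window p i m) s) (act (edge_label (p (i + int m)))))
      (scan (window p (i + int m + 1) k))"
  unfolding scan_window_append window_Suc by (cases "scan (window p i m) s") simp_all

lemma scan_window_snoc: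
  "scan (window p i (Suc m)) s =
    Option.bind (scan (window p i m) s) (act (edge_label (p (i + int m))))"
  using scan_window_insert[of p i m 0 s] by simp

text \<open>
  In a point of the shift, the cut just before position \<open>i\<close> is free iff no bracket opened to the left
  of it is ever closed to the right of it. Hence the opening at \<open>k\<close> is unmatched iff the cut \<open>k + 1\<close> is free.
\<close>

definition free :: "(int \<Rightarrow> edge) \<Rightarrow> int \<Rightarrow> bool" where
  "free p i \<longleftrightarrow> (\<forall>m. scan (window p i m) [] \<noteq> None)"

lemma free_translate: "free (translate s p) i \<longleftrightarrow> free p (i + s)"
  by (simp add: free_def window_translate)

lemma scan_to_free:
  assumes "scan (window p i m) [] \<noteq> None" "free p (i + int m)"
  shows "free p i"
  unfolding free_def
proof
  fix k
  show "scan (window p i k) [] \<noteq> None"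
  proof (cases "k \<le> m")
    case True
    then show ?thesis
      using assms(1) scan_window_append[of p i k "m - k" "[]"] by (auto simp: bind_eq_Some_conv)
  next
    case False
    then have "scan (window p i k) [] =
        Option.bind (scan (window p i m) []) (scan (window p (i + int m) (k - m)))"
      using scan_window_append[of p i m "k - m" "[]"] by simp
    then show ?thesis
      using assms scan_ne_None_mono[of "window p (i + int m) (k - m)"] by (auto simp: free_def)
  qed
qed

definition unmatched :: "(int \<Rightarrow> edge) \<Rightarrow> idx \<Rightarrow> int set" where
  "unmatched p n = {k. free p (k + 1) \<and> p k = BNeg n}"

text \<open>
  A neutral edge \<open>BPos1\<close> with a free cut behind it has a free cut in front of it as well, so it lies
  inside no matched bracket; it can therefore be traded against an unmatched \<open>BNeg I1\<close>.
\<close>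

definition switches :: "(int \<Rightarrow> edge) \<Rightarrow> int set" where
  "switches p = {k. free p (k + 1) \<and> p k \<in> {BNeg I1, BPos1}}"

definition set_switches :: "(int \<Rightarrow> edge) \<Rightarrow> int set \<Rightarrow> int \<Rightarrow> edge" where
  "set_switches p X k = (if k \<in> switches p then if k \<in> X then BNeg I1 else BPos1 else p k)"

lemma set_switches_cases:
  "set_switches p X k = p k \<or>
    free p (k + 1) \<and> p k \<in> {BNeg I1, BPos1} \<and> set_switches p X k \<in> {BNeg I1, BPos1}"
  by (auto simp: set_switches_def switches_def)

text \<open>
  Turning a switch into an opening or a neutral edge never makes a closing bracket fail, because behind
  a switch the run succeeds from any stack; so free cuts stay free. Conversely, no free cut lies between
  a cut that is not free and the first failure that witnesses this, and the edge that fails closes a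
  bracket; so the failing word contains no switch and survives the surgery.
\<close>

lemma free_set_switches [simp]: "free (set_switches p X) i \<longleftrightarrow> free p i"
proof
  let ?q = "set_switches p X"
  assume fr: "free p i"
  have "scan (window ?q i m) [] \<noteq> None" for m
  proof (induction m rule: less_induct)
    case (less m)
    define J where "J = {j. j < m \<and> ?q (i + int j) \<noteq> p (i + int j)}"
    show ?case
    proof (cases "J = {}")
      case True
      have "window ?q i m = window p i m"
        using True by (auto simp: J_def window_def)
      then show ?thesis using fr by (simp add: free_def)
    next
      case False
      have "finite J" by (simp add: J_def)
      \<comment> \<open>The last altered position: behind it the run is that of \<open>p\<close> from a free cut, which
        succeeds from every stack; up to it the induction hypothesis applies.\<close>
      define j where "j = Max J"
      have j: "j \<in> J" and jmax: "\<And>j'. j' \<in> J \<Longrightarrow> j' \<le> j"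
        using False \<open>finite J\<close> by (auto simp: j_def)
      have jm: "j < m" and "?q (i + int j) \<noteq> p (i + int j)" using j by (auto simp: J_def)
      then have fj: "free p (i + int j + 1)" and qj: "?q (i + int j) \<in> {BNeg I1, BPos1}"
        using set_switches_cases[of p X "i + int j"] by blast+
      define k where "k = m - Suc j"
      have m: "m = j + Suc k" using jm by (simp add: k_def)
      have tail: "window ?q (i + int j + 1) k = window p (i + int j + 1) k"
      proof (rule window_cong)
        fix l assume l: "i + int j + 1 \<le> l" "l < i + int j + 1 + int k"
        show "?q l = p l"
        proof (rule ccontr)
          assume "?q l \<noteq> p l"
          then have "nat (l - i) \<in> J" using l m by (simp add: J_def nat_less_iff)
          then show False using jmax[of "nat (l - i)"] l by auto
        qed
      qed
      obtain s where s: "scan (window ?q i j) [] = Some s" using less.IH[OF jm] by auto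
      obtain s' where s': "act (edge_label (?q (i + int j))) s = Some s'" using qj by auto
      have "scan (window p (i + int j + 1) k) s' \<noteq> None"
        using fj scan_ne_None_mono[of "window p (i + int j + 1) k" s']
        by (simp add: free_def del: not_None_eq)
      then show ?thesis
        unfolding m scan_window_insert by (simp add: s s' tail)
    qed
  qed
  then show "free ?q i" by (simp add: free_def)
next
  let ?q = "set_switches p X"
  assume fq: "free ?q i"
  show "free p i"
  proof (rule ccontr)
    assume nf: "\<not> free p i"
    then have "\<exists>m. scan (window p i m) [] = None" by (simp add: free_def)
    define m where "m = (LEAST m. scan (window p i m) [] = None)"
    have m: "scan (window p i m) [] = None"
      using \<open>\<exists>m. _\<close> unfolding m_def by (rule LeastI_ex)
    have before: "scan (window p i j) [] \<noteq> None" if "j < m" for j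
      using not_less_Least[OF that[unfolded m_def]] .
    have "window ?q i m = window p i m"
    proof (rule window_cong)
      fix k assume k: "i \<le> k" "k < i + int m"
      show "?q k = p k"
      proof (rule ccontr)
        assume "?q k \<noteq> p k"
        then have fk: "free p (k + 1)" and pk: "p k \<in> {BNeg I1, BPos1}"
          using set_switches_cases[of p X k] by blast+
        define j where "j = nat (k - i)"
        have j: "k = i + int j" "j < m" using k by (auto simp: j_def nat_less_iff)
        obtain s where s: "scan (window p i j) [] = Some s" using before[OF j(2)] by auto
        have "scan (window p i (Suc j)) [] \<noteq> None"
          unfolding scan_window_snoc using s pk j(1) by auto
        \<comment> \<open>A switch before the failure would make the cut \<open>i\<close> free.\<close>
        then have "free p i" using fk j(1) scan_to_free[of p i "Suc j"] by (simp add: ac_simps)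
        then show False using nf by simp
      qed
    qed
    with m have "scan (window ?q i m) [] = None" by simp
    then show False using fq unfolding free_def by blast
  qed
qed

lemma switches_set_switches [simp]: "switches (set_switches p X) = switches p"
  by (auto simp: switches_def) (auto simp: set_switches_def switches_def split: if_splits)

lemma unmatched_set_switches [simp]:
  "unmatched (set_switches p X) I0 = unmatched p I0"
  "unmatched (set_switches p X) I1 = X \<inter> switches p"
  by (auto simp: unmatched_def) (auto simp: set_switches_def switches_def split: if_splits)

lemma unmatched_I1_subset: "unmatched p I1 \<subseteq> switches p"
  by (auto simp: unmatched_def switches_def)

lemma switches_disjoint: "switches p \<inter> unmatched p I0 = {}"
  by (auto simp: unmatched_def switches_def)

lemma set_switches_inject:
  assumes "set_switches p X = set_switches q Y" "unmatched p I1 = unmatched q I1"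
  shows "p = q"
proof
  fix k
  have sw: "switches p = switches q"
    using assms(1) switches_set_switches by metis
  show "p k = q k"
  proof (cases "k \<in> switches p")
    case True
    then have "k \<in> switches q" "k \<in> unmatched p I1 \<longleftrightarrow> k \<in> unmatched q I1"
      using sw assms(2) by auto
    with True show ?thesis by (auto simp: switches_def unmatched_def)
  next
    case False
    then show ?thesis using fun_cong[OF assms(1), of k] sw by (simp add: set_switches_def)
  qed
qed

section \<open>Marked positions in gaps of the integers\<close>

text \<open>
  In this section \<open>C\<close> stands for the switches, \<open>D\<close> for the unmatched openings of type 0, which
  delimit the gaps, and \<open>P\<close>, \<open>Q\<close> for the switches that carry a 1. Positions are adjacent if they are
  successive switches of the same gap.
\<close>

definition adj :: "int set \<Rightarrow> int set \<Rightarrow> int \<Rightarrow> int \<Rightarrow> bool" where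
  "adj C D j k \<longleftrightarrow> j < k \<and> j \<in> C \<and> k \<in> C \<and> {j<..<k} \<inter> (C \<union> D) = {}"

text \<open>
  The new ones: a one with a next switch in its gap is kept and that next switch becomes
  a one too; a one that is the last switch of its gap disappears.
\<close>

definition spread :: "int set \<Rightarrow> int set \<Rightarrow> int set \<Rightarrow> int set" where
  "spread C D P = {k \<in> P. \<exists>l. adj C D k l} \<union> {k. \<exists>l\<in>P. adj C D l k}"

definition separates :: "int set \<Rightarrow> int set \<Rightarrow> bool" where
  "separates D P \<longleftrightarrow> (\<forall>j\<in>P. \<forall>k\<in>P. j < k \<longrightarrow> {j<..<k} \<inter> D \<noteq> {})"

lemma spread_subset: "P \<subseteq> C \<Longrightarrow> spread C D P \<subseteq> C"
  by (auto simp: spread_def adj_def)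

lemma int_least_above:
  assumes "(k::int) \<in> A" "j < k"
  obtains l where "l \<in> A" "j < l" "l \<le> k" "{j<..<l} \<inter> A = {}"
proof -
  have fin: "finite ({j<..k} \<inter> A)" and ne: "{j<..k} \<inter> A \<noteq> {}" using assms by auto
  define l where "l = Min ({j<..k} \<inter> A)"
  have "l \<in> {j<..k} \<inter> A" using Min_in[OF fin ne] by (simp add: l_def)
  moreover have "m \<notin> A" if "j < m" "m < l" for m
  proof
    assume "m \<in> A"
    then have "l \<le> m" unfolding l_def using that calculation by (intro Min_le[OF fin]) auto
    then show False using that by simp
  qed
  ultimately show thesis using that[of l] by (meson Int_iff disjoint_iff greaterThanAtMost_iff greaterThanLessThan_iff)
qed

lemma int_greatest_below:
  assumes "(k::int) \<in> A" "k < j"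
  obtains l where "l \<in> A" "l < j" "{l<..<j} \<inter> A = {}"
proof -
  have "- k \<in> uminus ` A" "- j < - k" using assms by auto
  then obtain l where l: "l \<in> uminus ` A" "- j < l" "{- j<..<l} \<inter> uminus ` A = {}"
    by (rule int_least_above)
  have no: "m \<notin> A" if "- l < m" "m < j" for m
  proof
    assume "m \<in> A"
    then have "- m \<in> {- j<..<l} \<inter> uminus ` A" using that by auto
    then show False using l by auto
  qed
  have "{- l<..<j} \<inter> A = {}" using no by auto
  then show thesis using l that[of "- l"] by auto
qed

lemma adj_exists:
  assumes "j \<in> C" "k \<in> C" "j < k" "{j<..<k} \<inter> D = {}"
  shows "\<exists>l. adj C D j l"
proof -
  obtain l where "l \<in> C" "j < l" "l \<le> k" "{j<..<l} \<inter> C = {}"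
    using int_least_above assms by metis
  then have "adj C D j l" using assms unfolding adj_def by fastforce
  then show ?thesis ..
qed

lemma gap_around:
  fixes a :: int
  assumes "\<And>i. \<exists>d\<in>D. d < i" "\<And>i. \<exists>d\<in>D. i < d" "a \<notin> D"
  obtains d d' where "d \<in> D" "d' \<in> D" "d < a" "a < d'" "{d<..<d'} \<inter> D = {}"
proof -
  obtain d where d: "d \<in> D" "d < a" "{d<..<a} \<inter> D = {}"
    using assms(1) int_greatest_below by metis
  obtain d' where d': "d' \<in> D" "a < d'" "{a<..<d'} \<inter> D = {}"
    using assms(2) int_least_above by metis
  have "{d<..<d'} \<subseteq> {d<..<a} \<union> {a} \<union> {a<..<d'}" by auto
  then have "{d<..<d'} \<inter> D = {}" using d d' assms(3) by blast
  then show thesis using that d d' by blast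
qed

lemma separatesD:
  assumes "separates D P" "j \<in> P" "k \<in> P" "{j<..<k} \<inter> D = {}" "{k<..<j} \<inter> D = {}"
  shows "j = k"
  using assms unfolding separates_def by (metis linorder_neqE)

lemma adj_no_separator: "adj C D j k \<Longrightarrow> {j<..<k} \<inter> D = {}"
  by (auto simp: adj_def)

lemma separates_adjD: "separates D P \<Longrightarrow> adj C D j k \<Longrightarrow> j \<in> P \<Longrightarrow> k \<in> P \<Longrightarrow> False"
  unfolding separates_def by (metis adj_def adj_no_separator)

lemma no_separator_join:
  fixes i :: int
  assumes "{i<..<j} \<inter> D = {}" "j \<notin> D" "{j<..<k} \<inter> D = {}"
  shows "{i<..<k} \<inter> D = {}"
proof -
  have "{i<..<k} \<subseteq> {i<..<j} \<union> {j} \<union> {j<..<k}" by auto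
  then show ?thesis using assms by blast
qed

lemma no_separator_sub:
  fixes i :: int
  assumes "{i<..<l} \<inter> D = {}" "i < j" "k < l"
  shows "{j<..<k} \<inter> D = {}"
proof -
  have "{j<..<k} \<subseteq> {i<..<l}" using assms(2,3) by auto
  then show ?thesis using assms(1) by blast
qed

text \<open>
  A gap of the result with two ones had its original one at the first of them; a gap without ones had
  it at the last switch. The proof runs through these two cases for a one \<open>a\<close> of \<open>P\<close> that \<open>Q\<close> lacks.
\<close>

lemma spread_inject_subset:
  assumes C: "C \<inter> D = {}" and PQ: "P \<subseteq> C" "Q \<subseteq> C"
    and unb: "\<And>i. \<exists>d\<in>D. d < i" "\<And>i. \<exists>d\<in>D. i < d"
    and P: "separates D P" and Q: "separates D Q" "separates Q D"
    and eq: "spread C D P = spread C D Q"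
  shows "P \<subseteq> Q"
proof
  fix a assume a: "a \<in> P"
  show "a \<in> Q"
  proof (rule ccontr)
    assume aQ: "a \<notin> Q"
    have aC: "a \<in> C" "a \<notin> D" using a PQ C by auto
    show False
    proof (cases "\<exists>l. adj C D a l")
      case True
      then obtain l where l: "adj C D a l" ..
      then have "a \<in> spread C D Q" "l \<in> spread C D Q" using a unfolding eq[symmetric] by (auto simp: spread_def)
      \<comment> \<open>Both \<open>a\<close> and the next switch \<open>l\<close> are ones of the result. Since \<open>a\<close> is not in \<open>Q\<close>, it was made
        a one by its predecessor \<open>b\<close>; but then nothing in \<open>Q\<close> accounts for \<open>l\<close>.\<close>
      then obtain b where b: "b \<in> Q" "adj C D b a" using aQ by (auto simp: spread_def)
      have "{b<..<l} \<inter> D = {}" using no_separator_join adj_no_separator b l aC by metis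
      then have "l \<notin> Q" using Q(1) b l unfolding separates_def adj_def by (meson less_trans)
      then obtain b' where b': "b' \<in> Q" "adj C D b' l"
        using \<open>l \<in> spread C D Q\<close> by (auto simp: spread_def)
      have "b' = a" using b'(2) l unfolding adj_def by (metis IntI UnI1 emptyE greaterThanLessThan_iff linorder_neqE)
      then show False using b' aQ by simp
    next
      case False
      obtain d d' where d: "d \<in> D" "d' \<in> D" "d < a" "a < d'" "{d<..<d'} \<inter> D = {}"
        using gap_around[OF unb aC(2)] by metis
      \<comment> \<open>Now \<open>a\<close> is the last switch of its gap, and the one \<open>b\<close> that \<open>Q\<close> has in this gap lies before it.
        So the result has ones in the gap, whereas \<open>P\<close> produces none there.\<close>
      obtain b where b: "b \<in> Q" "d < b" "b < d'"
        using Q(2) d unfolding separates_def by fastforce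
      have bC: "b \<in> C" "b \<notin> D" using b PQ C by auto
      have "b \<noteq> a" using aQ b by auto
      have sub: "{a<..<b} \<inter> D = {}" "{b<..<a} \<inter> D = {}" using no_separator_sub[OF d(5)] d b by blast+
      have "\<not> a < b" using adj_exists[OF aC(1) bC(1) _ sub(1)] False by blast
      then have "b < a" using \<open>b \<noteq> a\<close> by simp
      then have "b \<in> spread C D P"
        using adj_exists[OF bC(1) aC(1) _ sub(2)] b(1) unfolding eq by (auto simp: spread_def)
      moreover have "b \<notin> P" using separatesD[OF P a] sub \<open>b \<noteq> a\<close> by blast
      ultimately obtain b' where b': "b' \<in> P" "adj C D b' b" by (auto simp: spread_def)
      have "{b'<..<a} \<inter> D = {}" using no_separator_join adj_no_separator b' bC sub by metis
      moreover have "b' < a" using b' \<open>b < a\<close> by (auto simp: adj_def)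
      ultimately show False using P a b' unfolding separates_def by blast
    qed
  qed
qed

text \<open>
  A gap that contains a one receives either two ones or none, never exactly one.
\<close>

lemma spread_not_alternating:
  assumes C: "C \<inter> D = {}" and PC: "P \<subseteq> C" and ne: "P \<noteq> {}"
    and unb: "\<And>i. \<exists>d\<in>D. d < i" "\<And>i. \<exists>d\<in>D. i < d"
    and P: "separates D P"
    and E: "separates D (spread C D P)" "separates (spread C D P) D"
  shows False
proof -
  obtain a where a: "a \<in> P" using ne by blast
  have aC: "a \<in> C" "a \<notin> D" using a PC C by auto
  show False
  proof (cases "\<exists>l. adj C D a l")
    case True
    then obtain l where l: "adj C D a l" ..
    then have "a \<in> spread C D P" "l \<in> spread C D P" using a by (auto simp: spread_def)
    then show False using separates_adjD[OF E(1) l] by blast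
  next
    case False
    obtain d d' where d: "d \<in> D" "d' \<in> D" "d < a" "a < d'" "{d<..<d'} \<inter> D = {}"
      using gap_around[OF unb aC(2)] by metis
    obtain b where b: "b \<in> spread C D P" "d < b" "b < d'"
      using E(2) d unfolding separates_def by fastforce
    have uniq: "c = a" if "c \<in> P" "d < c" "c < d'" for c
    proof -
      have "{c<..<a} \<inter> D = {}" "{a<..<c} \<inter> D = {}" using no_separator_sub[OF d(5)] d that by blast+
      then show ?thesis using separatesD[OF P that(1) a] by blast
    qed
    from b(1) consider "b \<in> P" "\<exists>l. adj C D b l" | c where "c \<in> P" "adj C D c b"
      by (auto simp: spread_def)
    then show False
    proof cases
      case 1
      then show False using uniq[of b] b False by blast
    next
      case 2
      have "d < c"
        using 2 d(1) b(2) C unfolding adj_def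
        by (metis Int_iff UnI2 emptyE greaterThanLessThan_iff linorder_neqE)
      moreover have "c < d'" using 2 b by (auto simp: adj_def)
      ultimately show False using uniq[of c] 2 False by blast
    qed
  qed
qed


section \<open>Periodic points and their spines\<close>

definition has_period :: "(int \<Rightarrow> 'a) \<Rightarrow> nat \<Rightarrow> bool" where
  "has_period p n \<longleftrightarrow> (\<forall>i. p (i + int n) = p i)"

lemma period_multiple:
  assumes "has_period p n"
  shows "p (i + int n * z) = p i"
proof -
  have nat: "p (i + int n * int k) = p i" for i k
  proof (induction k)
    case (Suc k)
    have "p (i + int n * int (Suc k)) = p (i + int n * int k + int n)" by (simp add: algebra_simps)
    then show ?case using Suc assms by (simp add: has_period_def)
  qed simp
  show ?thesis
  proof (cases "z \<ge> 0")
    case True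
    then show ?thesis using nat[of i "nat z"] by simp
  next
    case False
    then show ?thesis using nat[of "i + int n * z" "nat (- z)"] by (simp add: algebra_simps)
  qed
qed

lemma window_period:
  assumes "has_period p n"
  shows "window p (i + int n * z) m = window p i m"
proof -
  have "p (i + int n * z + int j) = p (i + int j)" for j
    using period_multiple[of p n "i + int j" z] assms by (simp add: algebra_simps)
  then show ?thesis by (simp add: window_def)
qed

lemma min_period_props:
  assumes "periodic p"
  shows "min_period p \<ge> 1" "has_period p (min_period p)"
proof -
  have "min_period p \<ge> 1 \<and> (\<forall>i. p (i + int (min_period p)) = p i)"
    using assms unfolding min_period_def periodic_def by (rule LeastI_ex)
  then show "min_period p \<ge> 1" "has_period p (min_period p)" by (auto simp: has_period_def)
qed

lemma path_label_periods:
  assumes "has_period p n"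
  shows "path_label (window p i (k * n)) = path_label (window p i n) ^ k"
proof (induction k)
  case (Suc k)
  have "window p (i + int n) (k * n) = window p i (k * n)"
    using window_period[of p n i 1] assms by simp
  then show ?case using Suc by (simp add: window_append)
qed simp

lemma prod_neg_power:
  "prod_list (map \<alpha>neg v) ^ k = prod_list (map \<alpha>neg (concat (replicate k v)))"
  by (induction k) simp_all

lemma free_period:
  assumes "has_period p n"
  shows "free p (i + int n * z) \<longleftrightarrow> free p i"
  using window_period[OF assms] by (simp add: free_def)

lemma unmatched_period:
  assumes "has_period p n" "k \<in> unmatched p a"
  shows "k + int n * z \<in> unmatched p a"
  using assms(2) free_period[OF assms(1), of "k + 1" z] period_multiple[OF assms(1), of k z]
  by (simp add: unmatched_def algebra_simps)

text \<open>
  Any power of a product of negative generators only pushes and so never fails, and every window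
  from \<open>i\<close> is a prefix of a sufficiently long repetition of the period.
\<close>

lemma free_of_period:
  assumes "has_period p n" "n \<ge> 1" "path_label (window p i n) = prod_list (map \<alpha>neg v)"
  shows "free p i"
  unfolding free_def
proof
  fix m
  have "scan (window p i (m * n)) [] \<noteq> None"
    by (simp add: path_label_periods[OF assms(1)] assms(3) prod_neg_power act_prod_neg)
  moreover have "m * n = m + (m * n - m)" using assms(2) by (cases n) auto
  ultimately show "scan (window p i m) [] \<noteq> None"
    using scan_window_append[of p i m "m * n - m" "[]"] by (auto simp: bind_eq_Some_conv)
qed

text \<open>
  The spine of a point, letter by letter. Unlike \<^const>\<open>spine\<close>, it refers to the whole future of a
  position; the two agree on windows that end at a free cut (\<open>spine_window\<close>). In this form it is
  additive under concatenation of windows.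
\<close>

definition spine_letter :: "(int \<Rightarrow> edge) \<Rightarrow> int \<Rightarrow> idx list" where
  "spine_letter p k = (if free p (k + 1) then pushed (p k) else [])"

definition spine_word :: "(int \<Rightarrow> edge) \<Rightarrow> int \<Rightarrow> nat \<Rightarrow> idx list" where
  "spine_word p i m = concat (window (spine_letter p) i m)"

lemma spine_word_append: "spine_word p i (m + k) = spine_word p i m @ spine_word p (i + int m) k"
  by (simp add: spine_word_def window_append)

lemma set_spine_letter: "a \<in> set (spine_letter p k) \<longleftrightarrow> k \<in> unmatched p a"
  by (cases "p k") (auto simp: spine_letter_def unmatched_def)

lemma spine_letter_unmatched: "k \<in> unmatched p a \<Longrightarrow> spine_letter p k = [a]"
  by (simp add: spine_letter_def unmatched_def)

lemma set_spine_word: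
  "a \<in> set (spine_word p i m) \<longleftrightarrow> (\<exists>k. i \<le> k \<and> k < i + int m \<and> k \<in> unmatched p a)"
proof -
  have "(\<exists>j<m. i + int j \<in> unmatched p a) \<longleftrightarrow> (\<exists>k. i \<le> k \<and> k < i + int m \<and> k \<in> unmatched p a)"
    (is "?L \<longleftrightarrow> ?R")
  proof
    assume ?R
    then obtain k where "i \<le> k" "k < i + int m" "k \<in> unmatched p a" by blast
    then show ?L by (intro exI[of _ "nat (k - i)"]) (auto simp: nat_less_iff)
  next
    assume ?L
    then obtain j where "j < m" "i + int j \<in> unmatched p a" by blast
    then show ?R by (intro exI[of _ "i + int j"]) auto
  qed
  then show ?thesis by (auto simp: spine_word_def window_def set_spine_letter)
qed

lemma spine_window:
  "free p (i + int m) \<Longrightarrow> spine (window p i m) = spine_word p i m"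
proof (induction m arbitrary: i)
  case (Suc m)
  have fr: "free p (i + 1 + int m)" using Suc.prems by (simp add: algebra_simps)
  then have "scan (window p (i + 1) m) [] = None \<longleftrightarrow> \<not> free p (i + 1)"
    using scan_to_free[of p "i + 1" m] unfolding free_def by blast
  then show ?case
    using Suc.IH[OF fr] by (simp add: window_Suc spine_word_def spine_letter_def)
qed (simp add: spine_word_def)

lemma spine_word_of_scan:
  assumes "free p (i + int m)" "scan (window p i m) [] = Some u"
  shows "spine_word p i m = rev u"
  using scan_empty_spine[OF assms(2)] spine_window[OF assms(1)] by simp

text \<open>
  The period that starts with an unmatched opening begins and ends at a free cut, so its label is
  the product over its spine, which is nonempty.
\<close>

lemma has_neg_multiplierI:
  assumes "periodic p" "k \<in> unmatched p a"
  shows "has_neg_multiplier p"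
proof -
  obtain n where n: "min_period p = Suc n"
    using min_period_props(1)[OF assms(1)] by (cases "min_period p") auto
  have "scan (window p k 1) [] \<noteq> None" "free p (k + int 1)"
    using assms(2) by (auto simp: window_Suc unmatched_def)
  then have fr: "free p k" by (rule scan_to_free)
  then obtain u where u: "scan (window p k (Suc n)) [] = Some u"
    unfolding free_def by auto
  have "free p (k + int (Suc n))"
    using free_period[of p "Suc n" k 1] fr min_period_props(2)[OF assms(1)] n by simp
  from spine_word_of_scan[OF this u] have "rev u \<noteq> []"
    using spine_letter_unmatched[OF assms(2)] by (auto simp: spine_word_def window_Suc)
  then have "period_label p k \<in> dyck_neg"
    using prod_neg_in_dyck_neg scan_empty_label[OF u] by (simp add: period_label_def n)
  then show ?thesis unfolding has_neg_multiplier_def ..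
qed

section \<open>Points whose unmatched openings alternate\<close>

lemma multiplier_of_I0_I1_cases:
  assumes "w \<in> multiplier_of [I0, I1]"
  shows "w = [I0, I1] \<or> w = [I1, I0]"
proof -
  have "rotate k [I0, I1] = [I0, I1] \<or> rotate k [I0, I1] = [I1, I0]" for k
    by (induction k) auto
  then show ?thesis using assms by (auto simp: multiplier_of_def cyclic_rel_def)
qed

lemma successively_neq_alternating_word:
  "a \<noteq> b \<Longrightarrow> successively (\<noteq>) (concat (replicate k [a, b]))"
proof (induction k)
  case (Suc k)
  then show ?case by (cases k) auto
qed simp

text \<open>
  What the multiplier \<open>(\<alpha>(0)\<alpha>(1))\<^sub>-\<close> says about the unmatched openings, in a form that makes no reference
  to periods. Unboundedness ensures that the gaps between unmatched openings of type 0 cover the line.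
\<close>

definition alternating :: "(int \<Rightarrow> edge) \<Rightarrow> bool" where
  "alternating p \<longleftrightarrow>
    separates (unmatched p I0) (unmatched p I1) \<and> separates (unmatched p I1) (unmatched p I0) \<and>
    (\<forall>i. \<exists>d\<in>unmatched p I0. d < i) \<and> (\<forall>i. \<exists>d\<in>unmatched p I0. i < d) \<and> unmatched p I1 \<noteq> {}"

text \<open>
  Two successive unmatched openings of the same type, with no other in between, would give the spine two
  equal neighbouring letters.
\<close>

lemma separates_of_spine:
  assumes succ: "\<And>j m. successively (\<noteq>) (spine_word p j m)" and ab: "a \<noteq> b"
  shows "separates (unmatched p b) (unmatched p a)"
  unfolding separates_def
proof (intro ballI impI notI)
  fix j k assume jk: "j \<in> unmatched p a" "k \<in> unmatched p a" "j < k"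
    and none: "{j<..<k} \<inter> unmatched p b = {}"
  obtain l where l: "l \<in> unmatched p a" "j < l" "l \<le> k" "{j<..<l} \<inter> unmatched p a = {}"
    using int_least_above jk by metis
  define m where "m = nat (l - j - 1)"
  have lm: "l = j + 1 + int m" using l by (simp add: m_def)
  have "c \<notin> set (spine_word p (j + 1) m)" for c
  proof
    assume "c \<in> set (spine_word p (j + 1) m)"
    then obtain x where "j + 1 \<le> x" "x < j + 1 + int m" "x \<in> unmatched p c"
      by (auto simp: set_spine_word)
    then have x: "x \<in> {j<..<l}" "x \<in> {j<..<k}" "x \<in> unmatched p c" using l lm by auto
    have "c = a \<or> c = b" using ab by (cases a; cases b; cases c) auto
    then show False using x none l(4) by blast
  qed
  then have "spine_word p (j + 1) m = []" by (metis list.set_intros(1) neq_Nil_conv)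
  moreover have "spine_word p j 1 = [a]" "spine_word p l 1 = [a]"
    using jk l spine_letter_unmatched by (simp_all add: spine_word_def window_Suc)
  ultimately have "spine_word p j (1 + m + 1) = [a, a]"
    unfolding spine_word_append using lm by (simp add: add.assoc)
  then show False using succ[of j "1 + m + 1"] by simp
qed

lemma alternating_if_multiplier:
  assumes per: "periodic p" and mult: "has_multiplier_neg (multiplier_of [I0, I1]) p"
  shows "alternating p"
proof -
  define n where "n = min_period p"
  have n: "n \<ge> 1" "has_period p n"
    using min_period_props[OF per] by (auto simp: n_def)
  obtain i w \<kappa> where w: "w \<in> multiplier_of [I0, I1]" and \<kappa>: "\<kappa> \<ge> 1"
    and label: "path_label (window p i n) = prod_list (map \<alpha>neg w) ^ \<kappa>"
    using mult unfolding has_multiplier_neg_def period_label_def n_def by blast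
  obtain a b where ab: "w = [a, b]" "a \<noteq> b"
    using multiplier_of_I0_I1_cases[OF w] by auto
  have fr: "free p i"
    by (rule free_of_period[OF n(2) n(1)]) (simp only: label prod_neg_power)
  \<comment> \<open>All repetitions of the period, at all multiples of \<open>n\<close>, run between free cuts, so their
    spine is read off their label.\<close>
  have word: "spine_word p (i + int n * z) (k * n) = concat (replicate (\<kappa> * k) w)" for k z
  proof -
    have "path_label (window p (i + int n * z) (k * n)) = prod_list (map \<alpha>neg w) ^ (\<kappa> * k)"
      by (simp only: window_period[OF n(2)] path_label_periods[OF n(2)] label power_mult)
    then have "scan (window p (i + int n * z) (k * n)) [] = Some (rev (concat (replicate (\<kappa> * k) w)))"
      by (simp add: prod_neg_power act_prod_neg)
    moreover have "free p (i + int n * z + int (k * n))"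
      using free_period[OF n(2), of i "z + int k"] fr by (simp add: algebra_simps)
    ultimately show ?thesis using spine_word_of_scan by fastforce
  qed
  have succ: "successively (\<noteq>) (spine_word p j m)" for j m
  proof -
    define N where "N = nat \<bar>j - i\<bar> + m"
    \<comment> \<open>As the period is at least 1, going back \<open>N\<close> periods from \<open>i\<close> and forward \<open>2 N\<close> periods
      covers the given window.\<close>
    define i0 where "i0 = i + int n * (- int N)"
    have Nn: "int N \<le> int n * int N" using n(1) by (simp add: mult_le_cancel_right1)
    have bounds: "i0 \<le> j" "j + int m \<le> i0 + int (2 * N * n)"
      using Nn by (auto simp: i0_def N_def algebra_simps)
    define x where "x = nat (j - i0)"
    define y where "y = nat (i0 + int (2 * N * n) - (j + int m))"
    have sz: "2 * N * n = x + m + y" and j: "j = i0 + int x"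
      using bounds by (simp_all add: x_def y_def flip: of_nat_eq_iff[where 'a = int])
    have "successively (\<noteq>) (spine_word p i0 (2 * N * n))"
      unfolding i0_def word ab(1) using ab(2) by (rule successively_neq_alternating_word)
    then show ?thesis
      unfolding sz spine_word_append j[symmetric] by (simp add: successively_append_iff)
  qed
  have "c \<in> set (spine_word p i n)" for c
  proof -
    have "c = a \<or> c = b" using ab by (cases a; cases b; cases c) auto
    then show ?thesis using word[of 0 1] \<kappa> ab by (cases \<kappa>) auto
  qed
  then have ex: "\<exists>k. k \<in> unmatched p c" for c
    by (auto simp: set_spine_word)
  then obtain k where k: "k \<in> unmatched p I0" by blast
  have below: "\<exists>d\<in>unmatched p I0. d < j" for j
  proof -
    have "\<bar>k - j\<bar> \<le> int n * \<bar>k - j\<bar>" using n(1) by (simp add: mult_le_cancel_right1)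
    then have "k + int n * (- \<bar>k - j\<bar> - 1) < j" using n(1) by (simp add: algebra_simps)
    then show ?thesis using unmatched_period[OF n(2) k] by blast
  qed
  have above: "\<exists>d\<in>unmatched p I0. j < d" for j
  proof -
    have "\<bar>k - j\<bar> \<le> int n * \<bar>k - j\<bar>" using n(1) by (simp add: mult_le_cancel_right1)
    then have "j < k + int n * (\<bar>k - j\<bar> + 1)" using n(1) by (simp add: algebra_simps)
    then show ?thesis using unmatched_period[OF n(2) k] by blast
  qed
  show ?thesis
    unfolding alternating_def using below above ex[of I1] separates_of_spine[OF succ] by auto
qed

section \<open>The surgery on points\<close>

definition respread :: "(int \<Rightarrow> edge) \<Rightarrow> int \<Rightarrow> edge" where
  "respread p = set_switches p (spread (switches p) (unmatched p I0) (unmatched p I1))"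

lemma free_respread [simp]: "free (respread p) i \<longleftrightarrow> free p i"
  by (simp add: respread_def)

lemma switches_respread [simp]: "switches (respread p) = switches p"
  by (simp add: respread_def)

lemma unmatched_respread [simp]:
  "unmatched (respread p) I0 = unmatched p I0"
  "unmatched (respread p) I1 = spread (switches p) (unmatched p I0) (unmatched p I1)"
  using spread_subset[OF unmatched_I1_subset] by (auto simp: respread_def)

lemma unmatched_translate: "unmatched (translate s p) a = (\<lambda>k. k + s) -` unmatched p a"
  by (auto simp: unmatched_def free_translate algebra_simps)

lemma switches_translate: "switches (translate s p) = (\<lambda>k. k + s) -` switches p"
  by (auto simp: switches_def free_translate algebra_simps)

lemma ex_int_shift: "(\<exists>l::int. Q (l + s)) \<longleftrightarrow> (\<exists>l. Q l)"
  by (metis diff_add_cancel)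

lemma adj_translate:
  "adj ((\<lambda>k. k + s) -` C) ((\<lambda>k. k + s) -` D) j k \<longleftrightarrow> adj C D (j + s) (k + s)"
proof -
  have "{j<..<k} \<inter> ((\<lambda>k. k + s) -` C \<union> (\<lambda>k. k + s) -` D) = (\<lambda>k. k + s) -` ({j + s<..<k + s} \<inter> (C \<union> D))"
    by auto
  moreover have "(\<lambda>k. k + s) -` A = {} \<longleftrightarrow> A = {}" for A :: "int set"
    using ex_int_shift[of "\<lambda>l. l \<in> A" s] by auto
  ultimately show ?thesis unfolding adj_def by (simp only:) simp
qed

lemma spread_translate:
  "spread ((\<lambda>k. k + s) -` C) ((\<lambda>k. k + s) -` D) ((\<lambda>k. k + s) -` P) =
    (\<lambda>k. k + s) -` spread C D P"
proof -
  have "(\<exists>l. adj C D (k + s) (l + s)) \<longleftrightarrow> (\<exists>l. adj C D (k + s) l)" for k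
    by (rule ex_int_shift)
  moreover have "(\<exists>l. l + s \<in> P \<and> adj C D (l + s) (k + s)) \<longleftrightarrow> (\<exists>l. l \<in> P \<and> adj C D l (k + s))" for k
    by (rule ex_int_shift[of "\<lambda>l. l \<in> P \<and> adj C D l (k + s)" s for k])
  ultimately show ?thesis
    by (simp add: spread_def adj_translate set_eq_iff Bex_def)
qed

lemma respread_translate: "respread (translate s p) = translate s (respread p)"
  by (simp add: fun_eq_iff respread_def set_switches_def unmatched_translate switches_translate
      spread_translate)

text \<open>
  The data that steer the surgery, namely switches and unmatched openings of type 0, are the same for a
  point and its image, so only the positions of the ones have to be recovered.
\<close>

lemma respread_inject:
  assumes "alternating p" "alternating q" "respread p = respread q"
  shows "p = q"
proof -
  have sw: "switches p = switches q" using assms(3) switches_respread by metis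
  have U0: "unmatched p I0 = unmatched q I0" using assms(3) unmatched_respread(1) by metis
  have E: "spread (switches p) (unmatched p I0) (unmatched p I1) =
      spread (switches p) (unmatched p I0) (unmatched q I1)"
    using assms(3) unmatched_respread(2) sw U0 by metis
  have P: "unmatched p I1 \<subseteq> switches p" "unmatched q I1 \<subseteq> switches p"
    using unmatched_I1_subset sw by metis+
  have "unmatched p I1 \<subseteq> unmatched q I1"
    using assms(1,2) U0
    by (intro spread_inject_subset[OF switches_disjoint P _ _ _ _ _ E]) (auto simp: alternating_def)
  moreover have "unmatched q I1 \<subseteq> unmatched p I1"
    using assms(1,2) U0
    by (intro spread_inject_subset[OF switches_disjoint P(2,1) _ _ _ _ _ E[symmetric]])
      (auto simp: alternating_def)
  ultimately show ?thesis
    using set_switches_inject assms(3) unfolding respread_def by blast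
qed

lemma respread_not_alternating: "alternating p \<Longrightarrow> \<not> alternating (respread p)"
  using spread_not_alternating[OF switches_disjoint unmatched_I1_subset]
  unfolding alternating_def unmatched_respread by blast

lemma separates_translate:
  assumes "separates D P"
  shows "separates ((\<lambda>k. k + s) -` D) ((\<lambda>k. k + s) -` P)"
  unfolding separates_def
proof (intro ballI impI)
  fix j k assume "j \<in> (\<lambda>k. k + s) -` P" "k \<in> (\<lambda>k. k + s) -` P" "j < k"
  then obtain l where "j + s < l" "l < k + s" "l \<in> D"
    using assms unfolding separates_def by fastforce
  then have "l - s \<in> {j<..<k} \<inter> (\<lambda>k. k + s) -` D" by auto
  then show "{j<..<k} \<inter> (\<lambda>k. k + s) -` D \<noteq> {}" by blast
qed

lemma alternating_translate:
  assumes "alternating p"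
  shows "alternating (translate s p)"
proof -
  have *: "(\<exists>d. d + s \<in> A \<and> Q d) \<longleftrightarrow> (\<exists>d. d \<in> A \<and> Q (d - s))" for A Q
    using ex_int_shift[of "\<lambda>d. d \<in> A \<and> Q (d - s)" s] by simp
  have "(\<exists>d. d \<in> unmatched p I0 \<and> d - s < i)" "(\<exists>d. d \<in> unmatched p I0 \<and> i < d - s)" for i
    using assms unfolding alternating_def by (metis diff_less_eq less_diff_eq)+
  moreover have "\<exists>d. d + s \<in> unmatched p I1"
    using assms ex_int_shift[of "\<lambda>d. d \<in> unmatched p I1" s] unfolding alternating_def by blast
  ultimately show ?thesis
    using assms unfolding alternating_def unmatched_translate
    by (auto simp: separates_translate Bex_def *)
qed

lemma is_path_respread: "is_path (window (respread p) i m) \<longleftrightarrow> is_path (window p i m)"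
proof -
  have "src (respread p k) = src (p k) \<and> tgt (respread p k) = tgt (p k)" for k
    by (auto simp: respread_def set_switches_def switches_def)
  then show ?thesis by (simp add: is_path_def window_def successively_map)
qed

text \<open>
  The surgery exchanges parallel edges, so paths remain paths. Free cuts are unaffected and occur
  arbitrarily far to the left; the run from such a cut shows that every window has nonzero label.
\<close>

lemma respread_fib_dyck:
  assumes "p \<in> fib_dyck" "alternating p"
  shows "respread p \<in> fib_dyck"
proof -
  have "path_label (window (respread p) i m) \<noteq> 0" for i m
  proof -
    obtain d where d: "d \<in> unmatched p I0" "d < i"
      using assms(2) unfolding alternating_def by blast
    define x where "x = nat (i - (d + 1))"
    have i: "i = d + 1 + int x" using d by (simp add: x_def)
    have "free (respread p) (d + 1)" using d(1) by (simp add: unmatched_def)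
    then have "scan (window (respread p) (d + 1) (x + m)) [] \<noteq> None"
      unfolding free_def by blast
    then show ?thesis by (auto simp: window_append i bind_eq_Some_conv)
  qed
  then show ?thesis
    using assms(1) by (auto simp: fib_dyck_def admissible_def is_path_respread)
qed

text \<open>
  A period of the image is one of the point itself, by equivariance and injectivity.
\<close>

lemma respread_period:
  assumes "alternating p"
  shows "(\<forall>i. respread p (i + s) = respread p i) \<longleftrightarrow> (\<forall>i. p (i + s) = p i)"
proof -
  have "translate s (respread p) = respread p \<longleftrightarrow> translate s p = p"
    using respread_inject[OF alternating_translate[OF assms] assms]
    by (auto simp flip: respread_translate)
  then show ?thesis by (simp add: fun_eq_iff)
qed

lemma respread_min_period:
  assumes "alternating p"
  shows "periodic (respread p) \<longleftrightarrow> periodic p" "min_period (respread p) = min_period p"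
  using respread_period[OF assms] by (simp_all add: periodic_def min_period_def)

section \<open>Counting orbits with negative multiplier\<close>

lemma shift_orbit_refl: "p \<in> shift_orbit p"
  unfolding shift_orbit_def by (rule range_eqI[of _ _ 0]) simp

lemma translate_period:
  "(\<forall>i. translate s p (i + int k) = translate s p i) \<longleftrightarrow> (\<forall>i. p (i + int k) = p i)"
proof
  assume *: "\<forall>i. translate s p (i + int k) = translate s p i"
  show "\<forall>i. p (i + int k) = p i"
  proof
    fix i
    show "p (i + int k) = p i" using *[rule_format, of "i - s"] by (simp add: algebra_simps)
  qed
next
  assume *: "\<forall>i. p (i + int k) = p i"
  show "\<forall>i. translate s p (i + int k) = translate s p i"
    using *[rule_format, of "_ + s"] by (simp add: algebra_simps)
qed

lemma min_period_translate: "min_period (translate s p) = min_period p"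
  and periodic_translate: "periodic (translate s p) \<longleftrightarrow> periodic p"
  by (simp_all only: min_period_def periodic_def translate_period)

lemma has_multiplier_neg_translate:
  assumes "has_multiplier_neg \<mu> p"
  shows "has_multiplier_neg \<mu> (translate s p)"
proof -
  obtain i w \<kappa> where *: "w \<in> \<mu>" "\<kappa> \<ge> 1" "period_label p i = prod_list (map \<alpha>neg w) ^ \<kappa>"
    using assms unfolding has_multiplier_neg_def by blast
  have "period_label (translate s p) (i - s) = period_label p i"
    by (simp add: period_label_def min_period_translate window_translate)
  then show ?thesis unfolding has_multiplier_neg_def using * by metis
qed

lemma orbit_multiplier:
  assumes "S \<in> orbits_with n (has_multiplier_neg \<mu>)" "p \<in> S"
  shows "periodic p" "has_multiplier_neg \<mu> p"
  using assms
  by (auto simp: orbits_with_def shift_orbit_def periodic_translate has_multiplier_neg_translate)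

text \<open>
  A point of period \<open>n\<close> is the periodic continuation of its window \<open>[0, n)\<close>.
\<close>

lemma finite_orbits_with:
  shows "finite (orbits_with n P)"
proof (rule finite_subset)
  have "UNIV = {BNeg I0, BNeg I1, BPos I0, BPos I1, BNeg1, BPos1}"
    by (auto, metis edge.exhaust idx.exhaust)
  then have fin: "finite (UNIV :: edge set)" by (metis finite.emptyI finite.insertI)
  show "finite ((\<lambda>w. shift_orbit (\<lambda>i. w ! nat (i mod int n))) `
      {w :: edge list. set w \<subseteq> UNIV \<and> length w = n})"
    by (intro finite_imageI finite_lists_length_eq fin)
  show "orbits_with n P \<subseteq> (\<lambda>w. shift_orbit (\<lambda>i. w ! nat (i mod int n))) `
      {w :: edge list. set w \<subseteq> UNIV \<and> length w = n}"
  proof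
    fix S assume "S \<in> orbits_with n P"
    then obtain p where p: "S = shift_orbit p" "periodic p" "min_period p = n"
      by (auto simp: orbits_with_def)
    then have n: "n \<ge> 1" "has_period p n" using min_period_props by blast+
    have "window p 0 n ! nat (i mod int n) = p i" for i
    proof -
      have "window p 0 n ! nat (i mod int n) = p (i mod int n)"
        using n(1) by (simp add: window_def nat_less_iff)
      also have "\<dots> = p (i mod int n + int n * (i div int n))"
        using period_multiple[OF n(2), of "i mod int n" "i div int n"] by simp
      finally show ?thesis by simp
    qed
    then show "S \<in> (\<lambda>w. shift_orbit (\<lambda>i. w ! nat (i mod int n))) ` {w. set w \<subseteq> UNIV \<and> length w = n}"
      using p(1) by (intro image_eqI[of _ _ "window p 0 n"]) (auto simp: window_def)
  qed
qed

lemma respread_orbit: "respread ` shift_orbit p = shift_orbit (respread p)"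
  by (simp add: shift_orbit_def image_image respread_translate)

lemma has_neg_if_multiplier:
  assumes "has_multiplier_neg (multiplier_of [I0, I1]) p"
  shows "has_neg_multiplier p"
proof -
  obtain i w k where w: "w \<in> multiplier_of [I0, I1]" "k \<ge> 1"
    "period_label p i = prod_list (map \<alpha>neg w) ^ k"
    using assms unfolding has_multiplier_neg_def by blast
  have "concat (replicate k w) \<noteq> []"
    using w(2) multiplier_of_I0_I1_cases[OF w(1)] by (cases k) auto
  then have "period_label p i \<in> dyck_neg"
    unfolding w(3) prod_neg_power by (rule prod_neg_in_dyck_neg)
  then show ?thesis unfolding has_neg_multiplier_def ..
qed

abbreviation neg_orbits :: "nat \<Rightarrow> (int \<Rightarrow> edge) set set" where
  "neg_orbits n \<equiv> orbits_with n (has_multiplier_neg (multiplier_of [I0, I1]))"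

text \<open>
  The surgery maps the orbits with multiplier \<open>(\<alpha>(0)\<alpha>(1))\<^sub>-\<close> injectively to orbits of the same length
  with other negative multipliers; being disjoint, the two families, of equal size, both lie in
  the set of orbits with negative multiplier.
\<close>

lemma card_neg_orbits_le:
  "2 * card (neg_orbits n) \<le> card (orbits_with n has_neg_multiplier)"
proof -
  let ?A = "neg_orbits n" and ?N = "orbits_with n has_neg_multiplier"
  have sub: "?A \<subseteq> ?N"
    unfolding orbits_with_def using has_neg_if_multiplier by blast
  have alt: "alternating p" if "S \<in> ?A" "p \<in> S" for S p
    using orbit_multiplier[OF that] by (rule alternating_if_multiplier)
  have "inj_on ((`) respread) ?A"
  proof (rule inj_onI)
    fix S1 S2 assume S: "S1 \<in> ?A" "S2 \<in> ?A" "respread ` S1 = respread ` S2"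
    have "inj_on respread (S1 \<union> S2)"
      using alt[OF S(1)] alt[OF S(2)] respread_inject by (intro inj_onI) blast
    then show "S1 = S2" using S(3) by (metis Un_upper1 Un_upper2 inj_on_image_eq_iff)
  qed
  moreover have "(`) respread ` ?A \<subseteq> ?N - ?A"
  proof (intro subsetI)
    fix S' assume "S' \<in> (`) respread ` ?A"
    then obtain S where S: "S \<in> ?A" "S' = respread ` S" by blast
    then obtain p where p: "S = shift_orbit p" "p \<in> fib_dyck" "periodic p" "min_period p = n"
      by (auto simp: orbits_with_def)
    have ap: "alternating p" using alt S(1) p(1) shift_orbit_refl by blast
    have S': "S' = shift_orbit (respread p)" using S p respread_orbit by simp
    obtain k where "k \<in> unmatched (respread p) I0" using ap by (auto simp: alternating_def)
    then have "has_neg_multiplier (respread p)"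
      using respread_min_period[OF ap] p has_neg_multiplierI by blast
    then have "S' \<in> ?N"
      unfolding orbits_with_def S' using respread_min_period[OF ap] p respread_fib_dyck[OF _ ap] by blast
    moreover have "S' \<notin> ?A"
      using alt[of S' "respread p"] S' shift_orbit_refl respread_not_alternating[OF ap] by blast
    ultimately show "S' \<in> ?N - ?A" by blast
  qed
  ultimately have "card ?A \<le> card (?N - ?A)"
    using finite_orbits_with by (intro card_inj_on_le) auto
  also have "\<dots> = card ?N - card ?A"
    using sub finite_orbits_with by (intro card_Diff_subset) auto
  finally show ?thesis using card_mono[OF finite_orbits_with sub] by simp
qed

section \<open>Time reversal\<close>

fun flip_gen :: "gen \<Rightarrow> gen" where
  "flip_gen (Neg n) = Pos n"
| "flip_gen (Pos n) = Neg n"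

lemma flip_gen_flip_gen [simp]: "flip_gen (flip_gen g) = g"
  by (cases g) auto

abbreviation flip_word :: "gen list option \<Rightarrow> gen list option" where
  "flip_word \<equiv> map_option (\<lambda>w. rev (map flip_gen w))"

lemma flip_word_mult: "flip_word (free_mult x y) = free_mult (flip_word y) (flip_word x)"
  by (cases x; cases y) auto

lemma dyck_cong_flip: "dyck_cong x y \<Longrightarrow> dyck_cong (flip_word x) (flip_word y)"
proof (induction rule: dyck_cong.induct)
  case (cancel n)
  show ?case using dyck_cong.cancel by simp
next
  case (annihilate n m)
  then show ?case using dyck_cong.annihilate[of m n] by simp
next
  case (mult x x' y y')
  then show ?case by (simp only: flip_word_mult dyck_cong.mult)
qed (blast intro: dyck_cong.intros)+

text \<open>
  The anti-automorphism of the Dyck monoid that exchanges \<^term>\<open>\<alpha>neg n\<close> and \<^term>\<open>\<alpha>pos n\<close>. It is well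
  defined since it maps each defining relation to a defining relation.
\<close>

lift_definition flip :: "dyck \<Rightarrow> dyck" is flip_word
  by (rule dyck_cong_flip)

lemma flip_mult [simp]: "flip (x * y) = flip y * flip x"
  by transfer (simp only: flip_word_mult dyck_cong.refl)

lemma flip_simps [simp]: "flip 1 = 1" "flip 0 = 0" "flip (\<alpha>neg n) = \<alpha>pos n" "flip (\<alpha>pos n) = \<alpha>neg n"
  by (transfer, simp add: dyck_cong.refl)+

lemma flip_flip: "flip (flip x) = x"
  by transfer (simp add: option.map_comp comp_def rev_map option.map_ident dyck_cong.refl)

lemma flip_power: "flip (x ^ k) = flip x ^ k"
  by (induction k) (simp_all add: power_commutes)

lemma flip_prod_pos: "flip (prod_list (map \<alpha>pos (rev w))) = prod_list (map \<alpha>neg w)"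
  by (induction w) simp_all

text \<open>
  Each edge goes to the edge with opposite direction and flipped label, so reversing a path and
  flipping its edges gives a path.
\<close>

fun flip_edge :: "edge \<Rightarrow> edge" where
  "flip_edge (BNeg n) = BPos n"
| "flip_edge (BPos n) = BNeg n"
| "flip_edge BNeg1 = BPos1"
| "flip_edge BPos1 = BNeg1"

lemma flip_edge_flip_edge [simp]: "flip_edge (flip_edge e) = e"
  by (cases e) auto

lemma flip_edge_ends: "src (flip_edge e) = tgt e" "tgt (flip_edge e) = src e"
  by (cases e rule: src.cases; simp)+

lemma path_label_flip: "path_label (rev (map flip_edge b)) = flip (path_label b)"
proof (induction b)
  case (Cons e b)
  then show ?case by (cases e) auto
qed simp

lemma is_path_flip: "is_path (rev (map flip_edge b)) \<longleftrightarrow> is_path b"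
proof -
  have "(\<lambda>e f. src f = tgt e) = (\<lambda>e f. tgt e = src f)" by (intro ext) auto
  then show ?thesis
    by (simp only: is_path_def successively_rev successively_map flip_edge_ends)
qed

lemma admissible_flip: "admissible b \<Longrightarrow> admissible (rev (map flip_edge b))"
  unfolding admissible_def is_path_flip path_label_flip by (metis flip_flip flip_simps(2))

definition reversal :: "(int \<Rightarrow> edge) \<Rightarrow> int \<Rightarrow> edge" where
  "reversal p i = flip_edge (p (- i))"

lemma reversal_reversal [simp]: "reversal (reversal p) = p"
  by (simp add: reversal_def fun_eq_iff)

lemma window_reversal:
  "window (reversal p) i n = rev (map flip_edge (window p (1 - i - int n) n))"
  by (rule nth_equalityI) (auto simp: window_def reversal_def rev_nth algebra_simps)

lemma reversal_period:
  "(\<forall>i. reversal p (i + int k) = reversal p i) \<longleftrightarrow> (\<forall>i. p (i + int k) = p i)"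
proof -
  have "(\<forall>i. q (i + int k) = q i) \<Longrightarrow> (\<forall>i. reversal q (i + int k) = reversal q i)" for q
  proof
    fix i assume "\<forall>i. q (i + int k) = q i"
    then show "reversal q (i + int k) = reversal q i"
      unfolding reversal_def by (metis diff_add_cancel minus_add_distrib uminus_add_conv_diff add.commute)
  qed
  from this[of p] this[of "reversal p"] show ?thesis by auto
qed

lemma reversal_min_period:
  "periodic (reversal p) \<longleftrightarrow> periodic p" "min_period (reversal p) = min_period p"
  by (simp_all only: min_period_def periodic_def reversal_period)

lemma reversal_fib_dyck: "p \<in> fib_dyck \<Longrightarrow> reversal p \<in> fib_dyck"
  by (simp add: fib_dyck_def window_reversal admissible_flip)

lemma reversal_multiplier:
  assumes "has_multiplier_pos \<mu> p"
  shows "has_multiplier_neg \<mu> (reversal p)"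
proof -
  obtain i w \<kappa> where *: "w \<in> \<mu>" "\<kappa> \<ge> 1" "period_label p i = prod_list (map \<alpha>pos (rev w)) ^ \<kappa>"
    using assms unfolding has_multiplier_pos_def by blast
  have "period_label (reversal p) (1 - i - int (min_period p)) = flip (period_label p i)"
    by (simp add: period_label_def reversal_min_period window_reversal path_label_flip)
  also have "\<dots> = prod_list (map \<alpha>neg w) ^ \<kappa>"
    by (simp only: *(3) flip_power flip_prod_pos)
  finally show ?thesis unfolding has_multiplier_neg_def using *(1,2) by blast
qed

lemma reversal_orbit: "reversal ` shift_orbit p = shift_orbit (reversal p)"
proof -
  have "reversal (translate s p) = translate (- s) (reversal p)" for s
    by (simp add: reversal_def fun_eq_iff algebra_simps)
  then have "reversal ` shift_orbit p = range (\<lambda>s. translate (- s) (reversal p))"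
    by (simp add: shift_orbit_def image_image)
  also have "\<dots> = (\<lambda>s. translate s (reversal p)) ` range uminus"
    by (simp only: image_image)
  also have "range uminus = (UNIV :: int set)" by (metis surj_def minus_minus)
  finally show ?thesis by (simp only: shift_orbit_def)
qed

text \<open>
  Reversal carries the label \<open>(\<alpha>\<^sub>+(n\<^sub>J) \<dots> \<alpha>\<^sub>+(n\<^sub>1))\<^sup>\<kappa>\<close> to \<open>(\<alpha>\<^sub>-(n\<^sub>1) \<dots> \<alpha>\<^sub>-(n\<^sub>J))\<^sup>\<kappa>\<close>: the order of the indices
  is restored, so that the multiplier stays the same.
\<close>

lemma card_pos_le_card_neg:
  "card (orbits_with n (has_multiplier_pos \<mu>)) \<le> card (orbits_with n (has_multiplier_neg \<mu>))"
proof (rule card_inj_on_le)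
  have "inj reversal" by (metis injI reversal_reversal)
  then show "inj_on ((`) reversal) (orbits_with n (has_multiplier_pos \<mu>))"
    by (simp add: inj_on_def inj_image_eq_iff)
  show "(`) reversal ` orbits_with n (has_multiplier_pos \<mu>) \<subseteq> orbits_with n (has_multiplier_neg \<mu>)"
    unfolding orbits_with_def
    using reversal_fib_dyck reversal_min_period reversal_multiplier reversal_orbit by fastforce
qed (rule finite_orbits_with)

section \<open>Comparison of the counts\<close>

theorem lemma1:
  shows "\<not> exceptional (multiplier_of [I0, I1])"
proof -
  let ?\<mu> = "multiplier_of [I0, I1]"
  have "card (orbits_with n (has_multiplier_neg ?\<mu>) \<union> orbits_with n (has_multiplier_pos ?\<mu>)) \<le>
      card (orbits_with n has_neg_multiplier)" for n
  proof -
    have "card (orbits_with n (has_multiplier_neg ?\<mu>) \<union> orbits_with n (has_multiplier_pos ?\<mu>)) \<le>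
        card (orbits_with n (has_multiplier_neg ?\<mu>)) + card (orbits_with n (has_multiplier_pos ?\<mu>))"
      by (rule card_Un_le)
    also have "\<dots> \<le> 2 * card (orbits_with n (has_multiplier_neg ?\<mu>))"
      using card_pos_le_card_neg[of n ?\<mu>] by simp
    also have "\<dots> \<le> card (orbits_with n has_neg_multiplier)"
      by (rule card_neg_orbits_le)
    finally show ?thesis .
  qed
  then show ?thesis
    unfolding exceptional_def exceptional_at_def by (meson le_max_iff_disj linorder_not_less)
qed

end
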